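(* Let $G,M>0$ and let $\mathbf r:\mathbb R\to\mathbb R^2\setminus\{\mathbf 0\}$ be a twice differentiable solution of Newton's equation $\ddot{\mathbf r}(t)=-\dfrac{GM}{|\mathbf r(t)|^3}\,\mathbf r(t)$ for all $t\in\mathbb R$, with nonzero (constant) specific angular momentum $h=|\mathbf r\times\dot{\mathbf r}|\neq0$. Let $t_0$ be a periapsis time, and put $r_0=|\mathbf r(t_0)|$, $v_0=|\dot{\mathbf r}(t_0)|$ and $\mathbf e=\mathbf r(t_0)/r_0$. Then the ratio of the radial projection of the velocity to its projection onto the fixed direction $-\mathbf e$ is constant along the motion: for every $t\in\mathbb R$ with $\dot{\mathbf r}(t)\cdot(-\mathbf e)\neq 0$, $$\frac{\dot{\mathbf r}(t)\cdot\dfrac{\mathbf r(t)}{|\mathbf r(t)|}}{\dot{\mathbf r}(t)\cdot(-\mathbf e)}=\frac{r_0v_0^2-GM}{GM}.$$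
   Context: The motion takes place in the plane, with the central mass $M$ fixed at the origin; $G$ is the gravitational constant. For $\mathbf a,\mathbf b\in\mathbb R^2$, $|\mathbf a\times\mathbf b|=|a_1b_2-a_2b_1|$. A periapsis time is a time $t_0$ at which $t\mapsto|\mathbf r(t)|$ attains its global minimum over $\mathbb R$. *)

theory Defs
  imports "HOL-Analysis.Analysis"
begin

definition cross_norm :: "real ^ 2 \<Rightarrow> real ^ 2 \<Rightarrow> real" where
  "cross_norm a b = \<bar>a $ 1 * b $ 2 - a $ 2 * b $ 1\<bar>"

definition periapsis_time :: "(real \<Rightarrow> real ^ 2) \<Rightarrow> real \<Rightarrow> bool" where
  "periapsis_time r t0 \<longleftrightarrow> (\<forall>t. norm (r t0) \<le> norm (r t))"

end

(* The Laplace-Runge-Lenz vector A = |v|^2 r - (r . v) v - GM r/|r| is conserved.  At a periapsis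
   r . v = 0, so A = (r0 v0^2 - GM) e; at every time v . A = - GM (v . r/|r|).  Pairing the constant
   vector A with v at an arbitrary time gives the claim. *)
theory Submission
  imports Defs
begin

text \<open>In dimension three the first two terms are the double cross product of velocity with
  angular momentum, \<open>v\<close> x (\<open>x\<close> x \<open>v\<close>). Expanding it into
  inner products gives a vector that makes sense in the plane and in any real inner product
  space.\<close>

definition laplace_runge_lenz :: "real \<Rightarrow> 'a::real_inner \<Rightarrow> 'a \<Rightarrow> 'a" where
  "laplace_runge_lenz k x v = (v \<bullet> v) *\<^sub>R x - (x \<bullet> v) *\<^sub>R v - (k / norm x) *\<^sub>R x"

text \<open>Both velocity terms contribute (\<open>v\<close> . \<open>v\<close>)(\<open>x\<close> .
  \<open>v\<close>) with opposite signs, so only the radial term survives the pairing with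
  \<open>v\<close>.\<close>

lemma inner_laplace_runge_lenz:
  "v \<bullet> laplace_runge_lenz k x v = - k * (v \<bullet> (x /\<^sub>R norm x))"
  by (simp add: laplace_runge_lenz_def inner_diff_right inner_commute divide_inverse)

lemma laplace_runge_lenz_orthogonal:
  assumes "x \<noteq> 0" and "x \<bullet> v = 0"
  shows "laplace_runge_lenz k x v = (norm x * (norm v)\<^sup>2 - k) *\<^sub>R (x /\<^sub>R norm x)"
  using assms
  by (simp add: laplace_runge_lenz_def dot_square_norm divide_inverse left_diff_distrib
      scaleR_diff_left)

lemma has_real_derivative_norm:
  fixes r :: "real \<Rightarrow> 'a::real_inner"
  assumes "(r has_vector_derivative v) (at t)" and "r t \<noteq> 0"
  shows "((\<lambda>t. norm (r t)) has_real_derivative (r t \<bullet> v) / norm (r t)) (at t)"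
proof -
  have "((\<lambda>t. norm (r t)) has_derivative (\<lambda>h. (h *\<^sub>R v) \<bullet> sgn (r t))) (at t)"
    using has_derivative_compose[OF assms(1)[unfolded has_vector_derivative_def]
        has_derivative_norm[OF assms(2)]] by simp
  then show ?thesis
    by (rule has_derivative_imp_has_field_derivative)
      (simp add: sgn_div_norm inner_commute divide_inverse mult_ac)
qed

lemma has_real_derivative_inner:
  fixes f g :: "real \<Rightarrow> 'a::real_inner"
  assumes "(f has_vector_derivative f') (at t)" and "(g has_vector_derivative g') (at t)"
  shows "((\<lambda>t. f t \<bullet> g t) has_real_derivative f t \<bullet> g' + f' \<bullet> g t) (at t)"
proof -
  have "((\<lambda>t. f t \<bullet> g t) has_derivative (\<lambda>h. f t \<bullet> (h *\<^sub>R g') + (h *\<^sub>R f') \<bullet> g t)) (at t)"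
    using assms unfolding has_vector_derivative_def by (rule has_derivative_inner)
  then show ?thesis
    by (rule has_derivative_imp_has_field_derivative) (simp add: distrib_left mult.commute)
qed

text \<open>The acceleration is a multiple of \<open>r t\<close>, so the derivative of the vector is
  a combination of \<open>r t\<close> and \<open>v t\<close>; the inverse-square law makes both
  coefficients vanish.\<close>

lemma kepler_laplace_runge_lenz_constant:
  fixes r v :: "real \<Rightarrow> 'a::real_inner"
  assumes nz: "\<And>t. r t \<noteq> 0"
    and r: "\<And>t. (r has_vector_derivative v t) (at t)"
    and v: "\<And>t. (v has_vector_derivative (- (k / norm (r t) ^ 3)) *\<^sub>R r t) (at t)"
  shows "laplace_runge_lenz k (r t) (v t) = laplace_runge_lenz k (r u) (v u)"
proof -
  let ?A = "\<lambda>t. laplace_runge_lenz k (r t) (v t)"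
  have "(?A has_vector_derivative 0) (at t within UNIV)" for t
  proof -
    let ?a = "(- (k / norm (r t) ^ 3)) *\<^sub>R r t"
    have n: "norm (r t) \<noteq> 0" using nz by simp
    have k': "((\<lambda>t. k / norm (r t)) has_real_derivative - k * (r t \<bullet> v t) / norm (r t) ^ 3) (at t)"
      by (rule derivative_eq_intros has_real_derivative_norm[OF r nz] n refl)+
        (simp add: power3_eq_cube)
    have "(?A has_vector_derivative
        (((v t \<bullet> v t) *\<^sub>R v t + (v t \<bullet> ?a + ?a \<bullet> v t) *\<^sub>R r t)
        - ((r t \<bullet> v t) *\<^sub>R ?a + (r t \<bullet> ?a + v t \<bullet> v t) *\<^sub>R v t))
        - ((k / norm (r t)) *\<^sub>R v t + (- k * (r t \<bullet> v t) / norm (r t) ^ 3) *\<^sub>R r t)) (at t)"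
      unfolding laplace_runge_lenz_def
      by (intro has_vector_derivative_diff has_vector_derivative_scaleR
          has_real_derivative_inner r v k')
    \<comment> \<open>This value settles the coefficient of \<open>v t\<close>: the two
      \<open>v t \<bullet> v t\<close> cancel, and what remains is
      \<open>- (r t \<bullet> ?a) - k / norm (r t)\<close>, which is 0.\<close>
    moreover have "r t \<bullet> ?a = - (k / norm (r t))"
      using n by (simp add: dot_square_norm power2_eq_square power3_eq_cube)
    \<comment> \<open>Along \<open>r t\<close>, in units of
      \<open>k * (r t \<bullet> v t) / norm (r t) ^ 3\<close>, the contributions are -2 from
      differentiating the squared speed, +1 from the acceleration in the second term, and +1 from
      differentiating \<open>k / norm (r t)\<close>.\<close>
    then have "(((v t \<bullet> v t) *\<^sub>R v t + (v t \<bullet> ?a + ?a \<bullet> v t) *\<^sub>R r t)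
        - ((r t \<bullet> v t) *\<^sub>R ?a + (r t \<bullet> ?a + v t \<bullet> v t) *\<^sub>R v t))
        - ((k / norm (r t)) *\<^sub>R v t + (- k * (r t \<bullet> v t) / norm (r t) ^ 3) *\<^sub>R r t) = 0"
      by (simp add: algebra_simps inner_commute flip: scaleR_add_left)
    ultimately show ?thesis by simp
  qed
  then obtain c where "\<And>t. ?A t = c"
    using has_vector_derivative_zero_constant[of UNIV ?A] by auto
  then show ?thesis by simp
qed

text \<open>A minimum of the distance is also a minimum of its square
  \<open>r t \<bullet> r t\<close>, whose derivative at \<open>t0\<close> is twice the inner product
  in question.\<close>

lemma periapsis_orthogonal:
  assumes "periapsis_time r t0" and "(r has_vector_derivative v) (at t0)"
  shows "r t0 \<bullet> v = 0"
proof -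
  have "r t0 \<bullet> v + v \<bullet> r t0 = 0"
  \<comment> \<open>The minimum is global, so the radius 1 of the neighbourhood is an arbitrary
    choice.\<close>
  proof (rule DERIV_local_min[OF has_real_derivative_inner[OF assms(2) assms(2)] zero_less_one])
    show "\<forall>y. \<bar>t0 - y\<bar> < 1 \<longrightarrow> r t0 \<bullet> r t0 \<le> r y \<bullet> r y"
      using assms(1) by (simp add: periapsis_time_def dot_square_norm power_mono)
  qed
  then show ?thesis by (simp add: inner_commute)
qed

theorem mainTheorem2:
  fixes G M h r0 v0 t0 s :: real
    and r v :: "real \<Rightarrow> real ^ 2"
    and e :: "real ^ 2"
  assumes "G > 0" and "M > 0"
    and "\<And>t. r t \<noteq> 0"
    and "\<And>t. (r has_vector_derivative v t) (at t)"
    and "\<And>t. (v has_vector_derivative (- (G * M / norm (r t) ^ 3)) *\<^sub>R r t) (at t)"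
    and "h = cross_norm (r s) (v s)" and "h \<noteq> 0"
    and "periapsis_time r t0"
    and "r0 = norm (r t0)" and "v0 = norm (v t0)" and "e = r t0 /\<^sub>R r0"
  shows "\<forall>t. v t \<bullet> (- e) \<noteq> 0 \<longrightarrow>
    (v t \<bullet> (r t /\<^sub>R norm (r t))) / (v t \<bullet> (- e)) = (r0 * v0 ^ 2 - G * M) / (G * M)"
proof (intro allI impI)
  fix t
  assume ne: "v t \<bullet> (- e) \<noteq> 0"
  have "laplace_runge_lenz (G * M) (r t) (v t) = laplace_runge_lenz (G * M) (r t0) (v t0)"
    by (rule kepler_laplace_runge_lenz_constant[OF assms(3-5)])
  also have "\<dots> = (r0 * v0\<^sup>2 - G * M) *\<^sub>R e"
    using laplace_runge_lenz_orthogonal[OF assms(3) periapsis_orthogonal[OF assms(8,4)]]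
    by (simp add: assms(9-11))
  finally have "- (G * M) * (v t \<bullet> (r t /\<^sub>R norm (r t))) = (r0 * v0\<^sup>2 - G * M) * (v t \<bullet> e)"
    using inner_laplace_runge_lenz[of "v t" "G * M" "r t"] by simp
  \<comment> \<open>The minus sign moves into \<open>- e\<close>; this is the claim with
    denominators cleared.\<close>
  then have "(v t \<bullet> (r t /\<^sub>R norm (r t))) * (G * M) = (r0 * v0\<^sup>2 - G * M) * (v t \<bullet> (- e))"
    by (simp add: mult.commute)
  moreover have "G * M \<noteq> 0" using assms(1,2) by simp
  ultimately show "(v t \<bullet> (r t /\<^sub>R norm (r t))) / (v t \<bullet> (- e)) = (r0 * v0 ^ 2 - G * M) / (G * M)"
    using ne frac_eq_eq by blast
qed

end
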